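(* Let $f(x)\in\mathbb{Z}[x]$ be a monic irreducible monogenic polynomial, let $N$ be a positive integer that is not a perfect power, and let $a_1(x)\in\mathbb{Z}[x]$ be a monic factor of $f(x)$ over $\mathbb{Z}/N$. Write $$f(x)=f_1(x)N^s+a_1(x)^eA(x),$$ with $s,e\ge 1$ integers, $f_1,A\in\mathbb{Z}[x]$, $A$ monic, $f_1(x)\not\equiv 0\pmod N$, and $a_1(x)$ not dividing $A(x)$ over $\mathbb{Z}/N$. If $e\ge 2$, then $s=1$. Moreover (still with $e\ge 2$), if running the Euclidean procedure described in the context on $f_1(x)$, $a_1(x)$ and $N$ does not throw the exception of finding a non-trivial factor of $N$, then $(f_1(x),a_1(x),N)=1$ in $\mathbb{Z}[x]$.
   Context: A monic irreducible $f\in\mathbb{Z}[x]$ is called monogenic if $[O_K:\mathbb{Z}[x]/(f)]=1$, where $K=\mathbb{Q}[x]/(f)$ and $O_K$ is its ring of integers. "$(g,h,N)=1$ in $\mathbb{Z}[x]$" means that $g,h,N$ generate the unit ideal of $\mathbb{Z}[x]$. Divisibility "over $\mathbb{Z}/N$" means divisibility of the reductions in $(\mathbb{Z}/N)[x]$. Euclidean procedure on $(a,b,N)$, where $a,b\in\mathbb{Z}[x]$ are not multiples of $N$: if $N$ is a perfect power, a non-trivial factor of $N$ is found (exception). If any coefficient of $a$ or $b$ is a non-trivial zero divisor modulo $N$, a non-trivial factor of $N$ is found (exception). Otherwise write $a=a_1+Na_2$, $b=b_1+Nb_2$ with the leading coefficients of $a_1,b_1$ units modulo $N$; assuming $\deg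 a_1\ge\deg b_1$ (after swapping if necessary), divide $a_1$ by $b_1$ in $(\mathbb{Z}/N)[x]$ with quotient lifted to $q\in\mathbb{Z}[x]$, set $r=a-qb$, and replace $(a,b)$ by $(b,r)$. Repeat until the remainder is $0$ modulo $N$, so that the final pair has the form $(c,Nd)$ with $a\mathbb{Z}[x]+b\mathbb{Z}[x]=c\mathbb{Z}[x]+Nd\mathbb{Z}[x]$. *)

theory Defs
  imports
    "HOL-Algebra.Algebraic_Closure_Type"
    "HOL-Computational_Algebra.Nth_Powers"
    "Berlekamp_Zassenhaus.Poly_Mod"
begin

hide_const (open) Divisibility.irreducible Polynomials.degree up_ring.coeff

section \<open>Monogenic polynomials\<close>

abbreviation Zx :: "int poly ring"
  where "Zx \<equiv> ring_of_type_algebra"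

abbreviation Qx :: "rat poly ring"
  where "Qx \<equiv> ring_of_type_algebra"

definition number_field_ideal :: "int poly \<Rightarrow> rat poly set"
  where "number_field_ideal f = PIdl\<^bsub>Qx\<^esub> (map_poly rat_of_int f)"

definition number_field :: "int poly \<Rightarrow> rat poly set ring"
  where "number_field f = Qx Quot (number_field_ideal f)"

definition ring_of_integers :: "('a, 'b) ring_scheme \<Rightarrow> 'a set"
  where "ring_of_integers K =
    {\<alpha> \<in> carrier K. \<exists>p :: int poly. monic p \<and>
       (\<Oplus>\<^bsub>K\<^esub> i \<in> {..degree p}. [coeff p i] \<cdot>\<^bsub>K\<^esub> (\<alpha> [^]\<^bsub>K\<^esub> i)) = \<zero>\<^bsub>K\<^esub>}"

text \<open>For monic \<open>f\<close> the kernel of the natural map \<open>\<int>[x] \<rightarrow> \<rat>[x]/(f)\<close> is the ideal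
  generated by \<open>f\<close> in \<open>\<int>[x]\<close>, so that \<open>\<int>[x]/(f)\<close> is identified with its image.\<close>

definition equation_order :: "int poly \<Rightarrow> rat poly set set"
  where "equation_order f =
    range (\<lambda>g :: int poly. number_field_ideal f +>\<^bsub>Qx\<^esub> map_poly rat_of_int g)"

text \<open>The index is that of additive groups. As \<^const>\<open>card\<close> is \<open>0\<close> on infinite sets, an
  infinite index would not count as \<open>1\<close>.\<close>

definition monogenic :: "int poly \<Rightarrow> bool"
  where "monogenic f \<longleftrightarrow>
    card (a_rcosets\<^bsub>(number_field f)\<lparr>carrier := ring_of_integers (number_field f)\<rparr>\<^esub>
      (equation_order f)) = 1"

section \<open>The Euclidean procedure modulo \<open>N\<close>\<close>

text \<open>This makes \<open>1\<close> a perfect power. Integer bases are allowed; for \<open>N > 0\<close> this gives the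
  same notion as positive bases.\<close>

definition perfect_power :: "int \<Rightarrow> bool"
  where "perfect_power N \<longleftrightarrow> (\<exists>k\<ge>2. is_nth_power k N)"

definition nontrivial_zero_divisor :: "int \<Rightarrow> int \<Rightarrow> bool"
  where "nontrivial_zero_divisor N c \<longleftrightarrow>
    \<not> N dvd c \<and> (\<exists>d. \<not> N dvd d \<and> N dvd c * d)"

definition reveals_factor :: "int \<Rightarrow> int poly \<Rightarrow> int poly \<Rightarrow> bool"
  where "reveals_factor N a b \<longleftrightarrow> perfect_power N \<or>
    (\<exists>i. nontrivial_zero_divisor N (coeff a i) \<or> nontrivial_zero_divisor N (coeff b i))"

definition unit_lead_rep :: "int \<Rightarrow> int poly \<Rightarrow> int poly \<Rightarrow> bool"
  where "unit_lead_rep N a a\<^sub>1 \<longleftrightarrow>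
    (\<exists>a\<^sub>2. a = a\<^sub>1 + smult N a\<^sub>2) \<and> coprime (lead_coeff a\<^sub>1) N"

text \<open>\<open>q\<close> is any integral lift of the quotient of \<open>a\<^sub>1\<close> by \<open>b\<^sub>1\<close> in \<open>(\<int>/N)[x]\<close>, and \<open>t\<close> any
  lift of the remainder of that division that has the right degree.\<close>

definition euclid_remainder :: "int \<Rightarrow> int poly \<Rightarrow> int poly \<Rightarrow> int poly \<Rightarrow> bool"
  where "euclid_remainder N a b r \<longleftrightarrow>
    (\<exists>a\<^sub>1 b\<^sub>1 q t. unit_lead_rep N a a\<^sub>1 \<and> unit_lead_rep N b b\<^sub>1 \<and> degree b\<^sub>1 \<le> degree a\<^sub>1 \<and>
       poly_mod.eq_m N a\<^sub>1 (q * b\<^sub>1 + t) \<and> (t = 0 \<or> degree t < degree b\<^sub>1) \<and>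
       r = a - q * b)"

text \<open>\<open>Final c d\<close> stands for termination with the pair \<open>(c, N d)\<close>.\<close>

datatype euclid_outcome = Factor_Found | Final "int poly" "int poly"

text \<open>\<open>euclid N a b out\<close>: some run of the procedure on \<open>(a, b, N)\<close> has outcome \<open>out\<close>.
  Runs differ only in the choice of representatives and lifts, which affects neither the
  residues modulo \<open>N\<close> occurring in the run nor, consequently, whether a factor is found.\<close>

inductive euclid :: "int \<Rightarrow> int poly \<Rightarrow> int poly \<Rightarrow> euclid_outcome \<Rightarrow> bool"
  for N :: int
  where
    factor: "reveals_factor N a b \<Longrightarrow> euclid N a b Factor_Found"
  | swap: "\<lbrakk>\<not> reveals_factor N a b; unit_lead_rep N a a\<^sub>1; unit_lead_rep N b b\<^sub>1;
      degree a\<^sub>1 < degree b\<^sub>1; euclid N b a out\<rbrakk> \<Longrightarrow> euclid N a b out"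
  | final: "\<lbrakk>\<not> reveals_factor N a b; euclid_remainder N a b r; r = smult N d\<rbrakk>
      \<Longrightarrow> euclid N a b (Final b d)"
  | step: "\<lbrakk>\<not> reveals_factor N a b; euclid_remainder N a b r; \<not> poly_mod.eq_m N r 0;
      euclid N b r out\<rbrakk> \<Longrightarrow> euclid N a b out"

end

theory Submission
  imports Defs "Jordan_Normal_Form.Char_Poly"
begin

text \<open>Both conclusions are instances of one obstruction, in the spirit of Dedekind's index
  criterion (\<open>monogenic_common_factor_trivial\<close>): if \<open>f = N F + a\<^sup>2 B\<close> is monic and monogenic,
  with \<open>a\<close> and \<open>B\<close> monic, then no monic \<open>c\<close> of positive degree divides both \<open>a\<close> and \<open>F\<close>
  modulo \<open>N\<close>. For suppose that \<open>a \<equiv> c k\<close> modulo \<open>N\<close> with \<open>k\<close> monic, let \<open>\<theta>\<close> be the class of \<open>x\<close>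
  in \<open>K = \<rat>[x]/(f)\<close>, and put \<open>u = (k a B)(\<theta>)/N\<close>. The ideal \<open>I = (N, c(\<theta>))\<close> of \<open>\<int>[\<theta>]\<close>
  satisfies \<open>u I \<subseteq> I\<close>. Indeed \<open>u N = (k a B)(\<theta>)\<close> is a multiple of \<open>a(\<theta>)\<close>, which lies in \<open>I\<close>,
  and since \<open>f(\<theta>) = 0\<close>, the product \<open>u c(\<theta>)\<close> is \<open>a\<^sup>2 B / N = - F\<close> at \<open>\<theta>\<close> up to a multiple of
  \<open>a(\<theta>)\<close>, and \<open>F(\<theta>)\<close> lies in \<open>I\<close> as well. Now \<open>I\<close> is a finitely generated abelian group
  that contains the nonzero integer \<open>N\<close>, hence \<open>u\<close> is an algebraic integer
  (\<open>integral_if_stable_ideal\<close>, by the determinant trick). By monogenicity \<open>u\<close> lies in \<open>\<int>[\<theta>]\<close>,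
  so that \<open>f\<close> divides \<open>k a B\<close> modulo \<open>N\<close>. But \<open>k a B\<close> is monic, and its degree is smaller than
  that of \<open>f\<close> by the degree of \<open>c\<close>.

  In the theorem \<open>F = f\<^sub>1 N\<^bsup>s-1\<^esup>\<close>, \<open>a = a\<^sub>1\<close> and \<open>B = a\<^sub>1\<^bsup>e-2\<^esup> A\<close>. If \<open>s \<ge> 2\<close>, then \<open>F \<equiv> 0\<close>
  modulo \<open>N\<close>, and the obstruction with \<open>c = a\<^sub>1\<close> gives \<open>a\<^sub>1 = 1\<close>, which would divide \<open>A\<close>. If
  \<open>s = 1\<close>, a Euclidean procedure that never meets a zero divisor computes, as over a field, a
  monic common divisor \<open>c\<close> of \<open>f\<^sub>1\<close> and \<open>a\<^sub>1\<close> modulo \<open>N\<close> that is a combination of the two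
  modulo \<open>N\<close> (\<open>euclid_gcd\<close>). The obstruction gives \<open>c = 1\<close>, which is the claim.\<close>

section \<open>Division by monic polynomials\<close>

lemma monic_division:
  fixes g h :: "'a :: comm_ring_1 poly"
  assumes "monic g"
  obtains q r where "h = g * q + r" "r = 0 \<or> degree r < degree g"
proof -
  have "g \<noteq> 0" using assms by auto
  obtain q r where qr: "pseudo_divmod h g = (q, r)" by (cases "pseudo_divmod h g")
  from pseudo_divmod[OF \<open>g \<noteq> 0\<close> this] assms show ?thesis
    by (intro that[of q r]) auto
qed

text \<open>Division with remainder by a monic polynomial takes place over \<open>\<int>\<close> and agrees with the
  division over \<open>\<rat>\<close>, so the remainder vanishes over both or neither.\<close>

lemma dvd_of_int_poly_imp_dvd:
  assumes "monic f" and "map_poly rat_of_int f dvd map_poly rat_of_int g"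
  shows "f dvd g"
proof -
  obtain q r where g: "g = f * q + r" and r: "r = 0 \<or> degree r < degree f"
    using monic_division[OF assms(1)] by blast
  have "map_poly rat_of_int f dvd map_poly rat_of_int f * map_poly rat_of_int q + map_poly rat_of_int r"
    using assms(2) by (simp add: g hom_distribs)
  hence "map_poly rat_of_int f dvd map_poly rat_of_int r"
    using dvd_add_right_iff dvd_triv_left by blast
  hence "r = 0 \<or> degree f \<le> degree r"
    by (auto dest: dvd_imp_degree_le)
  with r g show ?thesis by auto
qed

lemma eq_m_iff_dvd: "poly_mod.eq_m N g h \<longleftrightarrow> [:N:] dvd g - h"
  by (simp add: poly_eq_iff poly_mod.Mp_coeff poly_mod.M_def const_poly_dvd_iff mod_eq_dvd_iff)

lemma dvdm_iff: "poly_mod.dvdm N c g \<longleftrightarrow> (\<exists>k m. g = c * k + [:N:] * m)"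
proof -
  have "[:N:] dvd g - c * k \<longleftrightarrow> (\<exists>m. g = c * k + [:N:] * m)" for k
    unfolding dvd_def by (simp only: diff_eq_eq add.commute)
  thus ?thesis by (simp only: poly_mod.dvdm_def eq_m_iff_dvd)
qed

text \<open>A monic \<open>c\<close> has no nonzero multiple of smaller degree modulo \<open>N\<close>, even if \<open>N\<close> is
  composite: reducing the multiple of \<open>N\<close> modulo \<open>c\<close> keeps it a multiple of \<open>N\<close>, and the
  difference to \<open>g\<close> becomes a multiple of \<open>c\<close> of too small a degree.\<close>

lemma monic_dvdm_small_imp_const_dvd:
  assumes "monic c" and "poly_mod.dvdm N c g" and "degree g < degree c"
  shows "[:N:] dvd g"
proof -
  obtain k m where g: "g = c * k + [:N:] * m" using assms(2) by (auto simp: dvdm_iff)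
  obtain q r where m: "m = c * q + r" and r: "r = 0 \<or> degree r < degree c"
    using monic_division[OF assms(1)] by blast
  have "g - [:N:] * r = c * (k + [:N:] * q)" by (simp add: g m algebra_simps)
  moreover have "degree (g - [:N:] * r) < degree c"
    using r assms(3) by (intro degree_diff_less) (auto intro: le_less_trans[OF degree_smult_le])
  ultimately have "g - [:N:] * r = 0"
    by (metis degree_mult_right_le leD mult_zero_right assms(1) dvd_imp_degree_le dvd_triv_left)
  thus ?thesis by (simp add: dvd_def) metis
qed

lemma monic_not_const_dvd:
  fixes g :: "int poly"
  assumes "N > 1" and "monic g"
  shows "\<not> [:N:] dvd g"
proof
  assume "[:N:] dvd g"
  hence "N dvd lead_coeff g" by (simp add: const_poly_dvd_iff)
  with assms show False by simp
qed

text \<open>The quotient of \<open>a\<close> by \<open>c\<close> over \<open>\<int>\<close> serves as the cofactor, because its remainder is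
  divisible by \<open>c\<close> modulo \<open>N\<close> and therefore a multiple of \<open>N\<close>.\<close>

lemma dvdm_monic_cofactor:
  assumes "N > 1" and "monic c" and "monic a" and "poly_mod.dvdm N c a"
  obtains k m where "monic k" "a = c * k + [:N:] * m" "degree a = degree c + degree k"
proof -
  obtain k t where a: "a = c * k + t" and t: "t = 0 \<or> degree t < degree c"
    using monic_division[OF assms(2)] by blast
  have "poly_mod.dvdm N c t"
  proof -
    obtain k' m' where "a = c * k' + [:N:] * m'" using assms(4) by (auto simp: dvdm_iff)
    hence "t = c * (k' - k) + [:N:] * m'" using a by (simp add: algebra_simps)
    thus ?thesis unfolding dvdm_iff by blast
  qed
  with t assms(2) have "[:N:] dvd t" by (auto intro: monic_dvdm_small_imp_const_dvd)
  then obtain m where m: "t = [:N:] * m" by (auto simp: dvd_def)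
  have "degree a \<ge> degree c"
    using monic_dvdm_small_imp_const_dvd[OF assms(2,4)] monic_not_const_dvd[OF assms(1,3)] by force
  hence t_small: "t = 0 \<or> degree t < degree a" using t by auto
  have ck: "c * k = a - t" using a by simp
  have "degree (c * k) = degree a \<and> monic (c * k)"
  proof (cases "t = 0")
    case False
    with t_small have "degree t < degree a" by simp
    hence "degree (- t + a) = degree a" by (intro degree_add_eq_right) simp
    moreover have "coeff (- t + a) (degree a) = 1"
      using \<open>degree t < degree a\<close> assms(3) by (simp add: coeff_eq_0)
    ultimately show ?thesis by (simp add: ck)
  qed (use ck assms(3) in simp)
  moreover from this have "k \<noteq> 0" by auto
  moreover have "c \<noteq> 0" using assms(2) by auto
  ultimately have "degree a = degree c + degree k" "monic k"
    using assms(2) coeff_mult_degree_sum[of c k] by (auto simp: degree_mult_eq)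
  with a m show ?thesis by (intro that[of k m]) auto
qed

section \<open>Integrality by determinants\<close>

text \<open>If multiplication by \<open>u\<close> acts on generators \<open>v\<^sub>0, \<dots>, v\<^bsub>n-1\<^esub>\<close> through an integer matrix \<open>M\<close>,
  then \<open>u \<cdot> 1 - M\<close> annihilates the vector of generators. Multiplying by the adjugate shows that
  \<open>det (u \<cdot> 1 - M)\<close>, the value at \<open>u\<close> of the characteristic polynomial of \<open>M\<close>, annihilates
  each of them. All of this is done modulo \<open>t\<close> in an arbitrary commutative ring, so that it
  applies to \<open>\<rat>[x]/(f)\<close> without a type for that quotient.\<close>

lemma determinant_trick:
  fixes u t :: "'a :: comm_ring_1" and v :: "nat \<Rightarrow> 'a" and M :: "nat \<Rightarrow> nat \<Rightarrow> int"
  assumes stable: "\<And>i. i < n \<Longrightarrow> t dvd u * v i - (\<Sum>j<n. of_int (M i j) * v j)"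
  obtains p :: "int poly" where "monic p"
    and "\<And>i. i < n \<Longrightarrow> t dvd poly (map_poly of_int p) u * v i"
proof -
  define A where "A = mat n n (\<lambda>(i, j). M i j)"
  define ev where "ev = (\<lambda>q :: int poly. poly (map_poly of_int q) u)"
  interpret ev: comm_ring_hom ev
    by unfold_locales (simp_all add: ev_def of_int_poly_hom.hom_add of_int_poly_hom.hom_mult)
  define B where "B = map_mat ev (char_poly_matrix A)"
  have A: "A \<in> carrier_mat n n" by (simp add: A_def)
  have B: "B \<in> carrier_mat n n" unfolding B_def using A by auto
  have ev_const: "ev [:c:] = of_int c" for c
    by (cases "c = 0") (simp_all add: ev_def map_poly_pCons)
  have B_entry: "B $$ (i, j) = (if i = j then u else 0) - of_int (M i j)"
    if "i < n" "j < n" for i j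
  proof -
    have "B $$ (i, j) = ev ((if i = j then [:0, 1:] else 0) + [:- M i j:])"
      using that by (simp add: B_def char_poly_matrix_def A_def del: add_pCons)
    also have "\<dots> = (if i = j then ev [:0, 1:] else 0) + ev [:- M i j:]"
      by (simp only: ev.hom_add) simp
    also have "ev [:0, 1:] = u"
      by (simp add: ev_def map_poly_pCons)
    finally show ?thesis by (simp add: ev_const)
  qed
  have Bv: "t dvd (\<Sum>j<n. B $$ (i, j) * v j)" if "i < n" for i
  proof -
    have "(\<Sum>j<n. B $$ (i, j) * v j) =
        (\<Sum>j<n. (if i = j then u * v j else 0) - of_int (M i j) * v j)"
      by (rule sum.cong) (auto simp: B_entry that algebra_simps)
    also have "\<dots> = u * v i - (\<Sum>j<n. of_int (M i j) * v j)"
      using that by (simp add: sum_subtractf)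
    finally show ?thesis using stable[OF that] by simp
  qed
  have det: "det B = ev (char_poly A)"
    unfolding B_def char_poly_def by (rule ev.hom_det)
  have "t dvd ev (char_poly A) * v i" if i: "i < n" for i
  proof -
    have "(\<Sum>k<n. adj_mat B $$ (i, k) * B $$ (k, j)) = (if i = j then det B else 0)"
      if j: "j < n" for j
    proof -
      have "(\<Sum>k<n. adj_mat B $$ (i, k) * B $$ (k, j)) = (adj_mat B * B) $$ (i, j)"
        using adj_mat(1)[OF B] B i j
        by (auto simp: scalar_prod_def atLeast0LessThan intro!: sum.cong)
      also have "\<dots> = (if i = j then det B else 0)"
        using i j by (simp add: adj_mat(3)[OF B])
      finally show ?thesis .
    qed
    hence "(\<Sum>j<n. (\<Sum>k<n. adj_mat B $$ (i, k) * B $$ (k, j)) * v j) =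
        (\<Sum>j<n. if i = j then det B * v j else 0)"
      by (intro sum.cong) auto
    hence "det B * v i = (\<Sum>j<n. \<Sum>k<n. adj_mat B $$ (i, k) * (B $$ (k, j) * v j))"
      using i by (simp add: sum_distrib_right mult.assoc)
    also have "\<dots> = (\<Sum>k<n. adj_mat B $$ (i, k) * (\<Sum>j<n. B $$ (k, j) * v j))"
      by (subst sum.swap) (simp add: sum_distrib_left)
    also have "t dvd \<dots>"
      by (intro dvd_sum dvd_mult Bv) auto
    finally show ?thesis by (simp add: det)
  qed
  moreover have "monic (char_poly A)"
    using degree_monic_char_poly[OF A] by simp
  ultimately show ?thesis
    by (intro that) (auto simp: ev_def)
qed

lemma sum_lessThan_add:
  "(\<Sum>j<n + m. g j) = (\<Sum>j<n. g j) + (\<Sum>j<m. (g (n + j) :: 'a :: comm_monoid_add))"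
  for n m :: nat
  by (induction m) (simp_all add: add.assoc)

lemma sum_monom_lessThan:
  assumes "p = 0 \<or> degree p < n"
  shows "(\<Sum>j<n. Polynomial.monom (coeff p j) j) = p"
  using assms by (intro poly_eqI) (auto simp: coeff_sum coeff_eq_0 not_less)

text \<open>The hypotheses say that \<open>u = g(\<theta>)/N\<close> maps the ideal \<open>(N, c(\<theta>))\<close> of \<open>\<int>[\<theta>]\<close> into
  itself, where \<open>\<theta>\<close> is a root of \<open>f\<close>. As an abelian group this ideal is generated by the
  \<open>N \<theta>\<^sup>j\<close> and \<open>c(\<theta>) \<theta>\<^sup>j\<close> with \<open>j < deg f\<close>, and on these the determinant trick operates.\<close>

lemma integral_if_stable_ideal:
  fixes f g c p\<^sub>1 q\<^sub>1 p\<^sub>2 q\<^sub>2 h :: "int poly" and N :: int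
  defines "u \<equiv> smult (1 / of_int N) (map_poly rat_of_int g)"
  assumes "monic f" and "degree f > 0" and "N \<noteq> 0"
    and g: "g = [:N:] * p\<^sub>1 + c * q\<^sub>1"
    and gc: "g * c = [:N:] * ([:N:] * p\<^sub>2 + c * q\<^sub>2) + f * h"
  obtains p :: "int poly" where "monic p"
    and "map_poly rat_of_int f dvd poly (map_poly of_int p) u"
proof -
  define n where "n = degree f"
  define R where "R = map_poly rat_of_int"
  define \<xi> where xi_def: "\<xi> = Polynomial.monom (1 :: rat) 1"
  define v where "v j = (if j < n then of_int N * \<xi> ^ j else R c * \<xi> ^ (j - n))" for j
  have R_add: "R (x + y) = R x + R y" and R_mult: "R (x * y) = R x * R y" for x y
    by (simp_all add: R_def of_int_poly_hom.hom_add of_int_poly_hom.hom_mult)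
  have R_const: "R [:a:] = of_int a" for a
    by (cases "a = 0") (simp_all add: R_def of_int_poly map_poly_pCons)
  have R_expand: "R r = (\<Sum>j<n. of_int (coeff r j) * \<xi> ^ j)" if "r = 0 \<or> degree r < n" for r
  proof -
    have "R r = (\<Sum>j<n. Polynomial.monom (coeff (R r) j) j)"
      using that by (intro sum_monom_lessThan[symmetric]) (auto simp: R_def)
    also have "\<dots> = (\<Sum>j<n. of_int (coeff r j) * \<xi> ^ j)"
      by (intro sum.cong) (simp_all add: R_def xi_def monom_power of_int_poly smult_monom)
    finally show ?thesis .
  qed
  \<comment> \<open>Reducing \<open>P\<close> and \<open>Q\<close> modulo \<open>f\<close> writes any element of the ideal in the generators.\<close>
  have span: "\<exists>z. R f dvd R ([:N:] * P + c * Q) - (\<Sum>j<n + n. of_int (z j) * v j)" for P Q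
  proof -
    obtain P1 P2 where P: "P = f * P1 + P2" "P2 = 0 \<or> degree P2 < n"
      using monic_division[OF \<open>monic f\<close>] unfolding n_def by blast
    obtain Q1 Q2 where Q: "Q = f * Q1 + Q2" "Q2 = 0 \<or> degree Q2 < n"
      using monic_division[OF \<open>monic f\<close>] unfolding n_def by blast
    define z where "z j = (if j < n then coeff P2 j else coeff Q2 (j - n))" for j
    have "(\<Sum>j<n + n. of_int (z j) * v j) =
        (\<Sum>j<n. of_int N * (of_int (coeff P2 j) * \<xi> ^ j)) +
        (\<Sum>j<n. R c * (of_int (coeff Q2 j) * \<xi> ^ j))"
      unfolding sum_lessThan_add
      by (intro arg_cong2[where f = "(+)"] sum.cong) (simp_all add: z_def v_def algebra_simps)
    also have "\<dots> = of_int N * R P2 + R c * R Q2"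
      by (simp add: R_expand[OF P(2)] R_expand[OF Q(2)] sum_distrib_left)
    finally have "R ([:N:] * P + c * Q) - (\<Sum>j<n + n. of_int (z j) * v j) =
        R f * (of_int N * R P1 + R c * R Q1)"
      by (simp only: P(1) Q(1) R_add R_mult R_const) (simp add: algebra_simps)
    thus ?thesis by (metis dvd_triv_left)
  qed
  have Nu: "of_int N * u = R g"
    using \<open>N \<noteq> 0\<close> by (simp add: u_def R_def of_int_poly)
  have "\<exists>z. R f dvd u * v i - (\<Sum>j<n + n. of_int (z j) * v j)" if "i < n + n" for i
  proof (cases "i < n")
    case True
    have "u * v i = (of_int N * u) * \<xi> ^ i" using True by (simp add: v_def algebra_simps)
    also have "\<dots> = R ([:N:] * (p\<^sub>1 * Polynomial.monom 1 i) + c * (q\<^sub>1 * Polynomial.monom 1 i))"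
      unfolding Nu g R_add R_mult by (simp add: R_def xi_def monom_power algebra_simps)
    finally show ?thesis using span by metis
  next
    case False
    define j where "j = i - n"
    have "of_int N * (u * R c) = R (g * c)"
      by (simp only: Nu R_mult mult.assoc[symmetric])
    also have "\<dots> = of_int N * R ([:N:] * p\<^sub>2 + c * q\<^sub>2) + R f * R h"
      by (simp only: gc R_add R_mult R_const)
    finally have "smult (1 / of_int N) (of_int N * (u * R c)) =
        smult (1 / of_int N) (of_int N * R ([:N:] * p\<^sub>2 + c * q\<^sub>2) + R f * R h)"
      by simp
    hence uc: "u * R c = R ([:N:] * p\<^sub>2 + c * q\<^sub>2) + R f * smult (1 / of_int N) (R h)"
      using \<open>N \<noteq> 0\<close> by (simp add: of_int_poly smult_add_right)
    have "u * v i = u * R c * \<xi> ^ j" using False by (simp add: v_def j_def)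
    also have "\<dots> = R ([:N:] * (p\<^sub>2 * Polynomial.monom 1 j) + c * (q\<^sub>2 * Polynomial.monom 1 j)) +
        R f * (smult (1 / of_int N) (R h) * \<xi> ^ j)"
      unfolding uc R_add R_mult by (simp add: R_def xi_def monom_power algebra_simps)
    finally have *: "u * v i = \<dots>" .
    obtain z where z: "R f dvd R ([:N:] * (p\<^sub>2 * Polynomial.monom 1 j) + c * (q\<^sub>2 * Polynomial.monom 1 j)) -
        (\<Sum>j<n + n. of_int (z j) * v j)"
      using span by metis
    have "u * v i - (\<Sum>j<n + n. of_int (z j) * v j) =
        (R ([:N:] * (p\<^sub>2 * Polynomial.monom 1 j) + c * (q\<^sub>2 * Polynomial.monom 1 j)) -
          (\<Sum>j<n + n. of_int (z j) * v j)) + R f * (smult (1 / of_int N) (R h) * \<xi> ^ j)"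
      unfolding * by (simp only: diff_add_eq)
    with z have "R f dvd u * v i - (\<Sum>j<n + n. of_int (z j) * v j)"
      by (simp only: dvd_add dvd_triv_left)
    thus ?thesis by blast
  qed
  hence "\<forall>i. \<exists>z. i < n + n \<longrightarrow> R f dvd u * v i - (\<Sum>j<n + n. of_int (z j) * v j)"
    by blast
  from choice[OF this] obtain M where
    M: "\<And>i. i < n + n \<Longrightarrow> R f dvd u * v i - (\<Sum>j<n + n. of_int (M i j) * v j)"
    by blast
  obtain p :: "int poly" where p: "monic p"
    and pv: "\<And>i. i < n + n \<Longrightarrow> R f dvd poly (map_poly of_int p) u * v i"
    by (rule determinant_trick[of "n + n" "R f" u v M]) (use M in blast)+
  \<comment> \<open>The first generator is the constant \<open>N\<close>, a unit in \<open>\<rat>[x]\<close>.\<close>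
  from pv[of 0] have "R f dvd smult (of_int N) (poly (map_poly of_int p) u)"
    using \<open>degree f > 0\<close> by (simp add: v_def n_def of_int_poly)
  hence "R f dvd poly (map_poly of_int p) u"
    using \<open>N \<noteq> 0\<close> by (simp add: dvd_smult_iff)
  with p show ?thesis by (intro that) (simp_all add: R_def)
qed

section \<open>The number field and its ring of integers\<close>

lemma type_algebra_simps:
  "carrier ring_of_type_algebra = UNIV"
  "x \<otimes>\<^bsub>ring_of_type_algebra\<^esub> y = x * y"
  "x \<oplus>\<^bsub>ring_of_type_algebra\<^esub> y = x + y"
  "\<one>\<^bsub>ring_of_type_algebra\<^esub> = 1"
  "\<zero>\<^bsub>ring_of_type_algebra\<^esub> = 0"
  by (simp_all add: ring_of_type_algebra_def)

lemma type_algebra_add_pow: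
  "[(k :: int)] \<cdot>\<^bsub>ring_of_type_algebra\<^esub> (x :: 'a :: comm_ring_1) = of_int k * x"
proof -
  interpret cring "ring_of_type_algebra :: 'a ring" by (rule cring_from_type_algebra)
  have nat: "[n] \<cdot>\<^bsub>ring_of_type_algebra\<^esub> x = of_nat n * x" for n :: nat
    unfolding add_pow_def
    by (induction n) (simp_all add: type_algebra_simps nat_pow_def algebra_simps)
  have minus: "\<ominus>\<^bsub>ring_of_type_algebra\<^esub> y = - y" for y :: 'a
    by (rule minus_equality) (simp_all add: type_algebra_simps)
  show ?thesis
    by (cases "k < 0") (simp_all add: add_pow_int_lt add_pow_int_ge nat minus)
qed

lemma type_algebra_finsum:
  "finite I \<Longrightarrow> finsum ring_of_type_algebra g I = (\<Sum>i\<in>I. (g i :: 'a :: comm_ring_1))"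
proof -
  interpret cring "ring_of_type_algebra :: 'a ring" by (rule cring_from_type_algebra)
  show "finite I \<Longrightarrow> ?thesis"
    by (induction I rule: finite_induct) (simp_all add: type_algebra_simps)
qed

abbreviation residue :: "int poly \<Rightarrow> rat poly \<Rightarrow> rat poly set" where
  "residue f g \<equiv> number_field_ideal f +>\<^bsub>Qx\<^esub> g"

lemma residue_altdef: "residue f g = {h. map_poly rat_of_int f dvd h - g}"
proof -
  have "h \<in> residue f g \<longleftrightarrow> (\<exists>k. h = k * map_poly rat_of_int f + g)" for h
    by (auto simp: a_r_coset_def' number_field_ideal_def cgenideal_def type_algebra_simps)
  moreover have "h = k * map_poly rat_of_int f + g \<longleftrightarrow> h - g = map_poly rat_of_int f * k" for h k
    by (auto simp: algebra_simps)
  ultimately show ?thesis by (auto simp: dvd_def)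
qed

lemma residue_eq_iff: "residue f g = residue f h \<longleftrightarrow> map_poly rat_of_int f dvd g - h"
proof
  assume "residue f g = residue f h"
  moreover have "g \<in> residue f g" by (simp add: residue_altdef)
  ultimately show "map_poly rat_of_int f dvd g - h" by (simp add: residue_altdef)
next
  assume gh: "map_poly rat_of_int f dvd g - h"
  have "k - h = (k - g) + (g - h)" for k :: "rat poly" by simp
  with gh show "residue f g = residue f h"
    unfolding residue_altdef by (metis dvd_add_left_iff)
qed

lemma residue_ring_hom: "ring_hom_cring Qx (number_field f) (residue f)"
proof -
  interpret Qx: cring Qx by (rule cring_from_type_algebra)
  interpret I: ideal "number_field_ideal f" Qx
    unfolding number_field_ideal_def by (rule Qx.cgenideal_ideal) (simp add: type_algebra_simps)
  show ?thesis
    unfolding number_field_def by (rule I.rcos_ring_hom_cring) (rule Qx.is_cring)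
qed

lemma zero_number_field: "\<zero>\<^bsub>number_field f\<^esub> = residue f 0"
proof -
  interpret ring_hom_cring Qx "number_field f" "residue f" by (rule residue_ring_hom)
  show ?thesis using hom_zero by (simp add: type_algebra_simps)
qed

text \<open>The canonical projection is a ring homomorphism, so an integral equation for a residue class
  is a divisibility by \<open>f\<close> in \<open>\<rat>[x]\<close>.\<close>

lemma residue_in_ring_of_integers_iff:
  "residue f u \<in> ring_of_integers (number_field f) \<longleftrightarrow>
    (\<exists>p :: int poly. monic p \<and> map_poly rat_of_int f dvd poly (map_poly of_int p) u)"
proof -
  interpret h: ring_hom_cring Qx "number_field f" "residue f" by (rule residue_ring_hom)
  have add_pow: "[(k :: int)] \<cdot>\<^bsub>number_field f\<^esub> residue f g = residue f (of_int k * g)" for k g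
  proof -
    have "residue f ([k] \<cdot>\<^bsub>Qx\<^esub> g) = [k] \<cdot>\<^bsub>number_field f\<^esub> residue f g"
      unfolding add_pow_def using h.R.a_group h.S.a_group
      by (intro hom_int_pow) (auto simp: hom_def type_algebra_simps h.hom_add[unfolded type_algebra_simps]
          intro: h.hom_closed[unfolded type_algebra_simps])
    thus ?thesis by (simp add: type_algebra_add_pow)
  qed
  have nat_pow: "residue f g [^]\<^bsub>number_field f\<^esub> n = residue f (g ^ n)" for g and n :: nat
    by (induction n) (simp_all add: type_algebra_simps h.hom_one[unfolded type_algebra_simps, symmetric]
        h.hom_mult[unfolded type_algebra_simps, symmetric] mult.commute)
  have eval: "poly (map_poly of_int p) u = (\<Sum>i\<le>degree p. of_int (coeff p i) * u ^ i)"
    for p :: "int poly"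
    by (simp add: poly_altdef)
  have "(\<Oplus>\<^bsub>number_field f\<^esub> i \<in> {..degree p}. [coeff p i] \<cdot>\<^bsub>number_field f\<^esub>
      (residue f u [^]\<^bsub>number_field f\<^esub> i)) = residue f (poly (map_poly of_int p) u)"
    for p :: "int poly"
    using h.hom_finsum[of "\<lambda>i. of_int (coeff p i) * u ^ i" "{..degree p}"]
    by (simp add: add_pow nat_pow eval type_algebra_finsum type_algebra_simps comp_def)
  moreover have "residue f u \<in> carrier (number_field f)"
    by (rule h.hom_closed) (simp add: type_algebra_simps)
  ultimately show ?thesis
    by (simp add: ring_of_integers_def zero_number_field residue_eq_iff)
qed

text \<open>Index \<open>1\<close> means that the ring of integers is a single coset of \<open>\<int>[\<theta>]\<close>, with \<open>\<theta>\<close> the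
  class of \<open>x\<close>; since it contains \<open>0\<close>, this coset is \<open>\<int>[\<theta>]\<close> itself.\<close>

lemma monogenicD:
  assumes "monogenic f" and "monic p"
    and "map_poly rat_of_int f dvd poly (map_poly of_int p) u"
  obtains h :: "int poly" where "map_poly rat_of_int f dvd u - map_poly rat_of_int h"
proof -
  interpret h: ring_hom_cring Qx "number_field f" "residue f" by (rule residue_ring_hom)
  define O_K where "O_K = ring_of_integers (number_field f)"
  define E where "E = equation_order f"
  define translate where "translate \<alpha> = (\<Union>\<beta>\<in>E. {\<beta> \<oplus>\<^bsub>number_field f\<^esub> \<alpha>})" for \<alpha>
  have "residue f u \<in> O_K"
    using assms unfolding O_K_def residue_in_ring_of_integers_iff by blast
  \<comment> \<open>Any monic polynomial without constant term vanishes at \<open>0\<close>.\<close>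
  moreover have "residue f 0 \<in> O_K"
    unfolding O_K_def residue_in_ring_of_integers_iff by (rule exI[of _ "[:0, 1:]"]) simp
  moreover have "card (\<Union>\<alpha>\<in>O_K. {translate \<alpha>}) = 1"
    using assms(1)
    by (simp add: monogenic_def A_RCOSETS_def' a_r_coset_def' translate_def O_K_def E_def)
  hence "is_singleton (\<Union>\<alpha>\<in>O_K. {translate \<alpha>})" by (simp add: is_singleton_altdef)
  ultimately have translate_eq: "translate (residue f u) = translate (residue f 0)"
    unfolding is_singleton_def by (metis UN_I singletonD singletonI)
  have "residue f 0 \<in> E"
    unfolding E_def equation_order_def by (rule range_eqI[of _ _ 0]) simp
  moreover have "residue f u = residue f 0 \<oplus>\<^bsub>number_field f\<^esub> residue f u"
    using h.hom_add[of 0 u] by (simp add: type_algebra_simps)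
  ultimately have "residue f u \<in> translate (residue f u)"
    unfolding translate_def by blast
  with translate_eq obtain g :: "int poly" where
    "residue f u = residue f (map_poly rat_of_int g) \<oplus>\<^bsub>number_field f\<^esub> residue f 0"
    by (auto simp: translate_def E_def equation_order_def)
  also have "\<dots> = residue f (map_poly rat_of_int g)"
    using h.hom_add[of "map_poly rat_of_int g" 0] by (simp add: type_algebra_simps)
  finally show ?thesis using that by (simp add: residue_eq_iff)
qed

section \<open>The obstruction to monogenicity\<close>

text \<open>The element that contradicts monogenicity is \<open>u = (k a B)(\<theta>)/N\<close>, where \<open>a \<equiv> c k\<close>
  modulo \<open>N\<close>. It behaves like \<open>f(\<theta>)/(N c(\<theta>))\<close> with \<open>f\<close> replaced by its residue \<open>a\<^sup>2 B\<close>
  modulo \<open>N\<close>.\<close>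

lemma monogenic_common_factor_trivial:
  fixes f F a B c :: "int poly" and N :: int
  assumes "monic f" and "monogenic f" and "N > 1"
    and f: "f = [:N:] * F + a\<^sup>2 * B"
    and "monic a" and "monic B" and "monic c"
    and "poly_mod.dvdm N c a" and "poly_mod.dvdm N c F"
  shows "c = 1"
proof (rule ccontr)
  assume "c \<noteq> 1"
  with \<open>monic c\<close> have c_pos: "degree c > 0" using monic_degree_0 by blast
  interpret poly_mod_2 N by unfold_locales (fact \<open>N > 1\<close>)
  obtain k m where k: "monic k" "a = c * k + [:N:] * m" "degree a = degree c + degree k"
    using dvdm_monic_cofactor[OF \<open>N > 1\<close> \<open>monic c\<close> \<open>monic a\<close> \<open>poly_mod.dvdm N c a\<close>] .
  obtain l n where F: "F = c * l + [:N:] * n"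
    using \<open>poly_mod.dvdm N c F\<close> by (auto simp: dvdm_iff)
  define g where "g = k * a * B"
  have nz: "k \<noteq> 0" "a \<noteq> 0" "B \<noteq> 0"
    using k(1) \<open>monic a\<close> \<open>monic B\<close> by (metis coeff_0 zero_neq_one)+
  have g_monic: "monic g" using k \<open>monic a\<close> \<open>monic B\<close> by (simp add: g_def lead_coeff_mult)
  have a2B: "monic (a\<^sup>2 * B)" using \<open>monic a\<close> \<open>monic B\<close> by (simp add: lead_coeff_mult lead_coeff_power)
  have "eq_m f (a\<^sup>2 * B)" unfolding eq_m_iff_dvd f by (simp del: mult_pCons_left)
  hence "degree f = degree (a\<^sup>2 * B)"
    using monic_degree_m[OF \<open>monic f\<close>] monic_degree_m[OF a2B] by simp
  hence deg_f: "degree f = degree g + degree c"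
    using nz k(3) by (simp add: g_def power2_eq_square degree_mult_eq)
  define u where "u = smult (1 / of_int N) (map_poly rat_of_int g)"
  \<comment> \<open>The next two identities express \<open>u N\<close> and \<open>u c(\<theta>)\<close> in the ideal \<open>(N, c(\<theta>))\<close>.\<close>
  have g: "g = [:N:] * (k * m * B) + c * (k * k * B)"
    unfolding g_def by (subst k(2)) (simp add: algebra_simps)
  have gc: "g * c = [:N:] * ([:N:] * (- n - m * m * B) + c * (- l - m * B * k)) + f * 1"
  proof -
    have "g * c = (c * k) * a * B" by (simp add: g_def mult.commute mult.left_commute)
    also have "c * k = a - [:N:] * m" using k(2) by simp
    also have "\<dots> * a * B = f - [:N:] * (F + m * B * a)"
      unfolding f by (simp only: power2_eq_square) (simp only: algebra_simps)
    also have "\<dots> = [:N:] * ([:N:] * (- n - m * m * B) + c * (- l - m * B * k)) + f * 1"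
      unfolding F by (subst k(2)) (simp only: algebra_simps)
    finally show ?thesis .
  qed
  have "degree f > 0" "N \<noteq> 0" using deg_f c_pos \<open>N > 1\<close> by simp_all
  from integral_if_stable_ideal[OF \<open>monic f\<close> this g gc]
  obtain p :: "int poly" where "monic p" "map_poly rat_of_int f dvd poly (map_poly of_int p) u"
    unfolding u_def .
  then obtain h where "map_poly rat_of_int f dvd u - map_poly rat_of_int h"
    by (rule monogenicD[OF \<open>monogenic f\<close>])
  hence "map_poly rat_of_int f dvd smult (of_int N) (u - map_poly rat_of_int h)"
    by (rule dvd_smult)
  also have "\<dots> = map_poly rat_of_int (g - [:N:] * h)"
    using \<open>N > 1\<close> by (simp add: u_def hom_distribs smult_diff_right)
  finally have "f dvd g - [:N:] * h" by (rule dvd_of_int_poly_imp_dvd[OF \<open>monic f\<close>])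
  hence "f dvdm g" unfolding dvdm_iff dvd_def by (metis diff_eq_eq)
  hence "[:N:] dvd g"
    using monic_dvdm_small_imp_const_dvd[OF \<open>monic f\<close>] deg_f c_pos by simp
  thus False using monic_not_const_dvd[OF \<open>N > 1\<close> g_monic] by simp
qed

section \<open>Greatest common divisors from the Euclidean procedure\<close>

text \<open>If \<open>N = g d\<close> with \<open>g = gcd x N\<close>, then \<open>d\<close> is annihilated by \<open>x\<close> modulo \<open>N\<close>, which forces
  \<open>g = 1\<close>.\<close>

lemma coprime_if_not_zero_divisor:
  assumes "N > 0" and "\<not> N dvd x" and "\<not> nontrivial_zero_divisor N x"
  shows "coprime x N"
proof -
  define g where "g = gcd x N"
  obtain x' where x: "x = g * x'" unfolding g_def by (rule dvdE[OF gcd_dvd1])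
  obtain d where N: "N = g * d" unfolding g_def by (rule dvdE[OF gcd_dvd2])
  have "g > 0" using \<open>N > 0\<close> by (simp add: g_def)
  hence "d > 0" using \<open>N > 0\<close> N by (simp add: zero_less_mult_iff)
  have "x * d = N * x'" by (simp add: x N)
  hence "N dvd x * d" by simp
  hence "N dvd d" using assms(2,3) by (auto simp: nontrivial_zero_divisor_def)
  hence "g * d \<le> 1 * d" using \<open>d > 0\<close> zdvd_imp_le[of N d] N by simp
  hence "g \<le> 1" using \<open>d > 0\<close> by (simp only: mult_le_cancel_right_pos)
  with \<open>g > 0\<close> have "g = 1" by simp
  thus ?thesis by (simp add: g_def coprime_iff_gcd_eq_1)
qed

text \<open>As long as no factor of \<open>N\<close> is revealed, every polynomial that is nonzero modulo \<open>N\<close> has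
  a unit as its leading coefficient modulo \<open>N\<close>, as over a field.\<close>

lemma unit_lead_rep_Mp:
  assumes "N > 0" and "\<not> poly_mod.eq_m N a 0"
    and "\<And>i. \<not> nontrivial_zero_divisor N (coeff a i)"
  shows "unit_lead_rep N a (poly_mod.Mp N a)"
proof -
  interpret poly_mod N .
  have "[:N:] dvd a - Mp a" unfolding eq_m_iff_dvd[symmetric] by simp
  then obtain k where "a - Mp a = [:N:] * k" by (rule dvdE)
  hence "a = Mp a + smult N k" by (simp add: algebra_simps)
  moreover have "lead_coeff (Mp a) \<noteq> 0" using assms(2) by simp
  hence "\<not> N dvd coeff a (degree (Mp a))" by (simp add: Mp_coeff M_def dvd_eq_mod_eq_0)
  hence "coprime (coeff a (degree (Mp a))) N"
    using assms by (intro coprime_if_not_zero_divisor)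
  hence "coprime (lead_coeff (Mp a)) N"
    using \<open>N > 0\<close> by (simp add: Mp_coeff M_def coprime_mod_left_iff)
  ultimately show ?thesis unfolding unit_lead_rep_def by blast
qed

lemma monic_associate:
  assumes "N > 1" and "unit_lead_rep N b b\<^sub>1"
  obtains b' w l where "monic b'" "degree b' = degree b\<^sub>1"
    "[:N:] dvd b' - smult w b" "[:N:] dvd b - smult l b'"
proof -
  interpret poly_mod N .
  define l where "l = lead_coeff b\<^sub>1"
  define w where "w = inverse_mod l N"
  define b' where "b' = Mp (smult w b\<^sub>1)"
  have "coprime l N" using assms(2) by (simp add: unit_lead_rep_def l_def)
  hence wl: "(w * l) mod N = 1" using \<open>N > 1\<close> by (simp add: w_def inverse_mod)
  obtain b\<^sub>2 where b: "b = b\<^sub>1 + smult N b\<^sub>2" using assms(2) by (auto simp: unit_lead_rep_def)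
  have "coeff b' (degree b\<^sub>1) = 1" using wl by (simp add: b'_def Mp_coeff M_def l_def)
  moreover have "degree b' \<le> degree b\<^sub>1"
    unfolding b'_def using degree_m_le_degree degree_smult_le le_trans by blast
  ultimately have deg: "degree b' = degree b\<^sub>1" by (metis le_antisym le_degree zero_neq_one)
  have "[:N:] dvd b' - smult w b\<^sub>1" unfolding eq_m_iff_dvd[symmetric] b'_def by simp
  then obtain k where "b' - smult w b\<^sub>1 = [:N:] * k" by (rule dvdE)
  hence "b' = smult w b\<^sub>1 + smult N k" by (simp add: algebra_simps)
  hence "b' - smult w b = [:N:] * (k - smult w b\<^sub>2)"
    by (simp add: b algebra_simps smult_add_right)
  hence b'_b: "[:N:] dvd b' - smult w b" by (rule dvdI)
  have "N dvd 1 - w * l" using wl \<open>N > 1\<close> by (simp add: mod_eq_dvd_iff[symmetric])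
  then obtain y where "1 - w * l = N * y" by (rule dvdE)
  hence "smult (1 - w * l) b = [:N:] * smult y b"
    by (simp add: mult.commute)
  hence "b - smult l (smult w b) = [:N:] * smult y b" by (simp add: smult_diff_left mult.commute)
  moreover have "b - smult l b' = (b - smult l (smult w b)) - smult l (b' - smult w b)"
    by (simp add: smult_diff_right)
  moreover have "[:N:] dvd smult l (b' - smult w b)" using b'_b by (rule dvd_smult)
  ultimately have "[:N:] dvd b - smult l b'" by (simp only: dvd_diff dvd_triv_left)
  with b'_b deg \<open>coeff b' (degree b\<^sub>1) = 1\<close> show ?thesis by (intro that) auto
qed

text \<open>These conditions say that \<open>(a, b, N) = (c, N)\<close> as ideals of \<open>\<int>[x]\<close>.\<close>

definition bezout_gcd_mod :: "int \<Rightarrow> int poly \<Rightarrow> int poly \<Rightarrow> int poly \<Rightarrow> bool" where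
  "bezout_gcd_mod N a b c \<longleftrightarrow> poly_mod.dvdm N c a \<and> poly_mod.dvdm N c b \<and>
    (\<exists>p q. [:N:] dvd c - (p * a + q * b))"

lemma bezout_gcd_mod_commute: "bezout_gcd_mod N a b c \<longleftrightarrow> bezout_gcd_mod N b a c"
  unfolding bezout_gcd_mod_def by (metis add.commute)

lemma bezout_gcd_mod_step:
  assumes "bezout_gcd_mod N b (a - q * b) c"
  shows "bezout_gcd_mod N a b c"
proof -
  obtain k m k' m' where b: "b = c * k + [:N:] * m" and r: "a - q * b = c * k' + [:N:] * m'"
    using assms unfolding bezout_gcd_mod_def dvdm_iff by blast
  have "a = q * b + (c * k' + [:N:] * m')" using r by (simp add: algebra_simps)
  hence "a = c * (q * k + k') + [:N:] * (q * m + m')"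
    by (subst (asm) b) (simp add: algebra_simps smult_add_right)
  moreover obtain x y where "[:N:] dvd c - (x * b + y * (a - q * b))"
    using assms unfolding bezout_gcd_mod_def by blast
  moreover have "x * b + y * (a - q * b) = y * a + (x - y * q) * b"
    by (simp add: algebra_simps)
  moreover have "poly_mod.dvdm N c b" using assms by (simp only: bezout_gcd_mod_def)
  ultimately show ?thesis
    unfolding bezout_gcd_mod_def dvdm_iff[of N c a] by (intro conjI) (blast | metis)+
qed

text \<open>The relation \<open>euclid\<close> allows all choices of representatives and lifts, so a single favourable
  run may be followed: it divides by a monic associate of the reduction of \<open>b\<close>, for which
  division with remainder is available. The degree of \<open>b\<close> modulo \<open>N\<close> drops in each step.\<close>

lemma euclid_gcd_ordered:
  assumes "N > 1" and "\<not> poly_mod.eq_m N a 0" and "\<not> poly_mod.eq_m N b 0"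
    and "degree (poly_mod.Mp N b) \<le> degree (poly_mod.Mp N a)"
    and "\<not> euclid N a b Factor_Found"
  shows "\<exists>c. monic c \<and> bezout_gcd_mod N a b c"
  using assms(2-)
proof (induction "degree (poly_mod.Mp N b)" arbitrary: a b rule: less_induct)
  case (less b a)
  interpret poly_mod N .
  have no_factor: "\<not> reveals_factor N a b" using less.prems euclid.factor by blast
  have rep_a: "unit_lead_rep N a (Mp a)" and rep_b: "unit_lead_rep N b (Mp b)"
    using no_factor less.prems \<open>N > 1\<close>
    by (auto intro!: unit_lead_rep_Mp simp: reveals_factor_def)
  obtain b' w l where b': "monic b'" "degree b' = degree (Mp b)"
    and b'_b: "[:N:] dvd b' - smult w b" and b_b': "[:N:] dvd b - smult l b'"
    using monic_associate[OF \<open>N > 1\<close> rep_b] .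
  obtain q t where A: "Mp a = b' * q + t" and t: "t = 0 \<or> degree t < degree b'"
    using monic_division[OF b'(1)] by blast
  define r where "r = a - smult w q * b"
  have ab: "eq_m (Mp a) (smult w q * Mp b + t)"
  proof -
    have "[:N:] dvd q * (b' - smult w b)" using b'_b by (rule dvd_mult)
    also have "q * (b' - smult w b) = Mp a - (smult w q * b + t)"
      by (simp add: A algebra_simps)
    finally have "eq_m (Mp a) (smult w q * b + t)" unfolding eq_m_iff_dvd .
    moreover have "Mp (smult w q * Mp b + t) = Mp (smult w q * b + t)"
      by (metis plus_Mp(1) mult_Mp(2))
    ultimately show ?thesis by simp
  qed
  have rem: "euclid_remainder N a b r"
    unfolding euclid_remainder_def r_def using rep_a rep_b ab t b'(2) less.prems(3) by fastforce
  \<comment> \<open>So \<open>r\<close> is small modulo \<open>N\<close>, although it may have large degree over \<open>\<int>\<close>.\<close>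
  have r_t: "Mp r = Mp t"
  proof -
    have "Mp r = Mp (Mp a - smult w q * Mp b)"
      unfolding r_def by (metis minus_Mp mult_Mp(2))
    also have "\<dots> = Mp (Mp (Mp a) - smult w q * Mp b)" by simp
    also have "\<dots> = Mp (smult w q * Mp b + t - smult w q * Mp b)"
      by (simp only: ab minus_Mp)
    finally show ?thesis by simp
  qed
  show ?case
  proof (cases "eq_m r 0")
    case True
    hence r0: "[:N:] dvd r" by (simp only: eq_m_iff_dvd diff_0_right)
    obtain k where k: "b = smult l b' + [:N:] * k"
      using b_b' by (metis dvdE diff_eq_eq add.commute)
    have "b' dvdm b" unfolding dvdm_iff k by (rule exI[of _ "[:l:]"]) auto
    moreover have "b' dvdm (a - smult w q * b)"
      using r0 unfolding r_def dvdm_iff dvd_def by (metis mult_zero_right add_0)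
    moreover have "[:N:] dvd b' - ([:w:] * b + 0 * (a - smult w q * b))"
      using b'_b by simp
    ultimately have "bezout_gcd_mod N b (a - smult w q * b) b'"
      unfolding bezout_gcd_mod_def by blast
    with b'(1) show ?thesis using bezout_gcd_mod_step by blast
  next
    case False
    have "t \<noteq> 0" using False r_t by auto
    hence smaller: "degree (Mp r) < degree (Mp b)"
      using t b'(2) degree_m_le_degree[of t] unfolding r_t by simp
    have "\<not> euclid N b r Factor_Found"
      using euclid.step[OF no_factor rem False] less.prems(4) by blast
    from less.hyps[OF smaller less.prems(2) False less_imp_le[OF smaller] this]
    show ?thesis unfolding r_def using bezout_gcd_mod_step by blast
  qed
qed

lemma euclid_gcd:
  assumes "N > 1" and "\<not> poly_mod.eq_m N a 0" and "\<not> poly_mod.eq_m N b 0"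
    and no_run: "\<not> euclid N a b Factor_Found"
  shows "\<exists>c. monic c \<and> bezout_gcd_mod N a b c"
proof (cases "degree (poly_mod.Mp N b) \<le> degree (poly_mod.Mp N a)")
  case True
  show ?thesis by (rule euclid_gcd_ordered[OF assms(1-3) True no_run])
next
  case False
  have no_factor: "\<not> reveals_factor N a b" using no_run euclid.factor by blast
  hence "unit_lead_rep N a (poly_mod.Mp N a)" "unit_lead_rep N b (poly_mod.Mp N b)"
    using assms by (auto intro!: unit_lead_rep_Mp simp: reveals_factor_def)
  hence "\<not> euclid N b a Factor_Found"
    using euclid.swap[OF no_factor] False no_run by force
  hence "\<exists>c. monic c \<and> bezout_gcd_mod N b a c"
    using assms False by (intro euclid_gcd_ordered) auto
  thus ?thesis by (simp add: bezout_gcd_mod_commute)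
qed

section \<open>Unit ideals and the theorem\<close>

text \<open>A combination of \<open>a\<close> and \<open>b\<close> that is \<open>1\<close> modulo \<open>N\<close> puts \<open>1\<close> into the ideal.\<close>

lemma Idl_const_eq_carrier:
  fixes a b :: "int poly"
  assumes "[:N:] dvd 1 - (p * a + q * b)"
  shows "Idl\<^bsub>Zx\<^esub> {a, b, [:N:]} = carrier Zx"
proof -
  interpret Zx: cring Zx by (rule cring_from_type_algebra)
  define J where "J = Idl\<^bsub>Zx\<^esub> {a, b, [:N:]}"
  have carrier: "carrier Zx = UNIV" by (simp add: ring_of_type_algebra_def)
  interpret J: ideal J Zx unfolding J_def by (rule Zx.genideal_ideal) (simp add: carrier)
  have gens: "a \<in> J" "b \<in> J" "[:N:] \<in> J"
    using Zx.genideal_self[of "{a, b, [:N:]}"] by (auto simp: J_def carrier)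
  have mult: "z * x \<in> J" if "x \<in> J" for x z
    using J.I_l_closed[OF that, of z] by (simp add: ring_of_type_algebra_def)
  have add: "x + y \<in> J" if "x \<in> J" "y \<in> J" for x y
    using J.a_closed[OF that] by (simp add: ring_of_type_algebra_def)
  obtain k where "1 - (p * a + q * b) = [:N:] * k" using assms by (rule dvdE)
  hence "1 = p * a + q * b + k * [:N:]" by (simp add: algebra_simps)
  hence "1 \<in> J" using add[OF add[OF mult[OF gens(1)] mult[OF gens(2)]] mult[OF gens(3)]] by metis
  thus ?thesis unfolding J_def[symmetric] by (intro J.one_imp_carrier) (simp add: ring_of_type_algebra_def)
qed

theorem lemma5:
  fixes f f\<^sub>1 a\<^sub>1 A :: "int poly" and N :: int and s e :: nat
  assumes "monic f" and "irreducible f" and "monogenic f"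
    and "N > 0" and "\<not> perfect_power N"
    and "monic a\<^sub>1" and "poly_mod.dvdm N a\<^sub>1 f"
    and "f = f\<^sub>1 * [:N:] ^ s + a\<^sub>1 ^ e * A"
    and "s \<ge> 1" and "e \<ge> 1"
    and "monic A"
    and "\<not> poly_mod.eq_m N f\<^sub>1 0"
    and "\<not> poly_mod.dvdm N a\<^sub>1 A"
    and "e \<ge> 2"
  shows "s = 1 \<and>
    (\<not> euclid N f\<^sub>1 a\<^sub>1 Factor_Found \<longrightarrow> Idl\<^bsub>Zx\<^esub> {f\<^sub>1, a\<^sub>1, [:N:]} = carrier Zx)"
proof -
  have "N \<noteq> 1"
  proof
    assume "N = 1"
    hence "is_nth_power 2 N" by (simp add: is_nth_power_def) (metis power_one)
    thus False using \<open>\<not> perfect_power N\<close> by (auto simp: perfect_power_def)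
  qed
  with \<open>N > 0\<close> have "N > 1" by simp
  define F where "F = f\<^sub>1 * [:N:] ^ (s - 1)"
  define B where "B = a\<^sub>1 ^ (e - 2) * A"
  have "monic B"
    using \<open>monic a\<^sub>1\<close> \<open>monic A\<close> by (simp add: B_def lead_coeff_mult lead_coeff_power)
  have "f\<^sub>1 * [:N:] ^ s = [:N:] * F"
    using \<open>s \<ge> 1\<close> by (cases s) (simp_all add: F_def)
  moreover have "a\<^sub>1 ^ e = a\<^sub>1\<^sup>2 * a\<^sub>1 ^ (e - 2)"
    using \<open>e \<ge> 2\<close> by (simp only: power_add[symmetric] le_add_diff_inverse)
  ultimately have f: "f = [:N:] * F + a\<^sub>1\<^sup>2 * B"
    using assms(8) by (simp only: B_def mult.assoc)
  have trivial: "c = 1" if "monic c" "poly_mod.dvdm N c a\<^sub>1" "poly_mod.dvdm N c F" for c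
    using monogenic_common_factor_trivial[OF \<open>monic f\<close> \<open>monogenic f\<close> \<open>N > 1\<close> f \<open>monic a\<^sub>1\<close>
        \<open>monic B\<close> that] .
  have "s = 1"
  proof (rule ccontr)
    assume "s \<noteq> 1"
    with \<open>s \<ge> 1\<close> obtain i where "s - 1 = Suc i" by (cases "s - 1") auto
    hence "F = a\<^sub>1 * 0 + [:N:] * (f\<^sub>1 * [:N:] ^ i)" by (simp add: F_def)
    hence "poly_mod.dvdm N a\<^sub>1 F" unfolding dvdm_iff by blast
    moreover have "poly_mod.dvdm N a\<^sub>1 a\<^sub>1"
      unfolding dvdm_iff by (rule exI[of _ 1], rule exI[of _ 0]) simp
    ultimately have "a\<^sub>1 = 1" using trivial \<open>monic a\<^sub>1\<close> by blast
    hence "A = a\<^sub>1 * A + [:N:] * 0" by simp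
    hence "poly_mod.dvdm N a\<^sub>1 A" unfolding dvdm_iff by blast
    with \<open>\<not> poly_mod.dvdm N a\<^sub>1 A\<close> show False ..
  qed
  moreover have "Idl\<^bsub>Zx\<^esub> {f\<^sub>1, a\<^sub>1, [:N:]} = carrier Zx" if "\<not> euclid N f\<^sub>1 a\<^sub>1 Factor_Found"
  proof -
    have "\<not> poly_mod.eq_m N a\<^sub>1 0"
      using monic_not_const_dvd[OF \<open>N > 1\<close> \<open>monic a\<^sub>1\<close>] by (simp add: eq_m_iff_dvd)
    with euclid_gcd[OF \<open>N > 1\<close> \<open>\<not> poly_mod.eq_m N f\<^sub>1 0\<close> _ that]
    obtain c where "monic c" and c: "bezout_gcd_mod N f\<^sub>1 a\<^sub>1 c" by blast
    hence "c = 1" using trivial \<open>s = 1\<close> by (simp add: bezout_gcd_mod_def F_def)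
    with c show ?thesis unfolding bezout_gcd_mod_def using Idl_const_eq_carrier by blast
  qed
  ultimately show ?thesis by blast
qed

end
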